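(* Let $\mathfrak{g}$ be any Lie algebra over $\mathbb{C}$ and $\mathfrak{M}$ any $\mathfrak{g}$-module (both possibly infinite-dimensional). Endow $\mathfrak{M}$ with the abelian Lie bracket. Then for every $n$ the cohomology groups with trivial coefficients of the semi-direct sum $\mathfrak{g}\ltimes\mathfrak{M}$ split as $$H^n(\mathfrak{g}\ltimes\mathfrak{M})\cong\bigoplus_{k+\ell=n}H^k\big(\mathfrak{g};\textstyle\bigwedge^{\ell}\mathfrak{M}^*\big),$$ where $\mathfrak{M}^*=\mathrm{Hom}(\mathfrak{M},\mathbb{C})$ is the dual of $\mathfrak{M}$ and $\bigwedge^\ell\mathfrak{M}^*$ means $\mathrm{Hom}(\bigwedge^\ell\mathfrak{M},\mathbb{C})$, the $\mathfrak{g}$-module of alternating $\ell$-linear forms on $\mathfrak{M}$.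
   Context: $H^k(\mathfrak{g};N)$ is Lie algebra (Chevalley–Eilenberg) cohomology with coefficients in a $\mathfrak{g}$-module $N$, and $H^n(\mathfrak{h})=H^n(\mathfrak{h};\mathbb{C})$ for the trivial module. The sum is over integers $k,\ell\ge0$. The bracket of $\mathfrak{g}\ltimes\mathfrak{M}$ satisfies $[x,v]=x\cdot v$ for $x\in\mathfrak{g}$, $v\in\mathfrak{M}$ and $[v,w]=0$ for $v,w\in\mathfrak{M}$. *)

theory Defs
  imports
    "HOL-Analysis.Product_Vector"
    "HOL-Library.FuncSet"
    "HOL-Library.Function_Algebras"
    "HOL-Library.Set_Algebras"
begin

section \<open>Lie algebras and their modules\<close>

text \<open>The underlying space of a Lie algebra is a whole type. The underlying space of a module is
  a subspace of a type, because alternating forms of a given degree do not form a type.\<close>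

record 'a lie_alg =
  lscale :: "complex \<Rightarrow> 'a \<Rightarrow> 'a"
  lbracket :: "'a \<Rightarrow> 'a \<Rightarrow> 'a"

record ('a, 'v) lie_mod =
  mcarrier :: "'v set"
  mscale :: "complex \<Rightarrow> 'v \<Rightarrow> 'v"
  mact :: "'a \<Rightarrow> 'v \<Rightarrow> 'v"

locale lie_algebra =
  fixes \<gg> :: "'a::ab_group_add lie_alg"
  assumes vector_space: "vector_space (lscale \<gg>)"
    and linear_left: "Vector_Spaces.linear (lscale \<gg>) (lscale \<gg>) (\<lambda>x. lbracket \<gg> x y)"
    and linear_right: "Vector_Spaces.linear (lscale \<gg>) (lscale \<gg>) (\<lambda>y. lbracket \<gg> x y)"
    and bracket_self: "lbracket \<gg> x x = 0"
    and jacobi: "lbracket \<gg> x (lbracket \<gg> y z) + lbracket \<gg> y (lbracket \<gg> z x)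
      + lbracket \<gg> z (lbracket \<gg> x y) = 0"

locale lie_module = lie_algebra \<gg>
  for \<gg> :: "'a::ab_group_add lie_alg" +
  fixes N :: "('a, 'v::ab_group_add) lie_mod"
  assumes mod_vector_space: "vector_space (mscale N)"
    and mod_subspace: "module.subspace (mscale N) (mcarrier N)"
    and act_closed: "v \<in> mcarrier N \<Longrightarrow> mact N x v \<in> mcarrier N"
    and act_add_left: "v \<in> mcarrier N \<Longrightarrow> mact N (x + y) v = mact N x v + mact N y v"
    and act_scale_left:
      "v \<in> mcarrier N \<Longrightarrow> mact N (lscale \<gg> c x) v = mscale N c (mact N x v)"
    and act_add_right:
      "v \<in> mcarrier N \<Longrightarrow> w \<in> mcarrier N \<Longrightarrow> mact N x (v + w) = mact N x v + mact N x w"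
    and act_scale_right:
      "v \<in> mcarrier N \<Longrightarrow> mact N x (mscale N c v) = mscale N c (mact N x v)"
    and act_bracket: "v \<in> mcarrier N \<Longrightarrow>
      mact N (lbracket \<gg> x y) v = mact N x (mact N y v) - mact N y (mact N x v)"

definition trivial_module :: "('a, complex) lie_mod"
  where "trivial_module = \<lparr>mcarrier = UNIV, mscale = (*), mact = (\<lambda>x v. 0)\<rparr>"

lemma trivial_module_lie_module: "lie_algebra \<gg> \<Longrightarrow> lie_module \<gg> trivial_module"
proof -
  assume g: "lie_algebra \<gg>"
  have v: "vector_space ((*) :: complex \<Rightarrow> _)"
    by unfold_locales (auto simp: algebra_simps)
  interpret v: vector_space "(*) :: complex \<Rightarrow> _" by (rule v)
  show ?thesis
    using g v by (auto simp: lie_module_def lie_module_axioms_def trivial_module_def)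
qed

text \<open>Only meaningful for a module whose underlying space is the whole type.\<close>

definition semidirect ::
  "'a::ab_group_add lie_alg \<Rightarrow> ('a, 'm::ab_group_add) lie_mod \<Rightarrow> ('a \<times> 'm) lie_alg"
  where "semidirect \<gg> M =
    \<lparr>lscale = module_prod.scale (lscale \<gg>) (mscale M),
     lbracket = (\<lambda>(x, v) (y, w). (lbracket \<gg> x y, mact M x w - mact M y v))\<rparr>"

lemma semidirect_lie_algebra:
  assumes "lie_module \<gg> M" "mcarrier M = UNIV"
  shows "lie_algebra (semidirect \<gg> M)"
proof -
  interpret lie_module \<gg> M by fact
  interpret g: vector_space "lscale \<gg>" by (rule vector_space)
  interpret m: vector_space "mscale M" by (rule mod_vector_space)
  interpret p: vector_space_prod "lscale \<gg>" "mscale M" ..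
  interpret l: Vector_Spaces.linear "lscale \<gg>" "lscale \<gg>" "\<lambda>x. lbracket \<gg> x y" for y
    by (rule linear_left)
  interpret r: Vector_Spaces.linear "lscale \<gg>" "lscale \<gg>" "\<lambda>y. lbracket \<gg> x y" for x
    by (rule linear_right)
  note acts = act_add_left act_add_right act_scale_left act_scale_right act_bracket
  note acts' = acts[unfolded assms(2), simplified]
  have z: "mact M x 0 = 0" for x
    using acts'(2)[of x 0 0] by simp
  have mi: "mact M x (v - w) = mact M x v - mact M x w" for x v w
    using acts'(2)[of x "v - w" w] by simp
  have J: "lbracket \<gg> x (lbracket \<gg> y z) + (lbracket \<gg> y (lbracket \<gg> z x)
      + lbracket \<gg> z (lbracket \<gg> x y)) = 0" for x y z
    using jacobi[of x y z] by (simp only: add.assoc)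
  show ?thesis
    by unfold_locales
      (auto simp: semidirect_def p.scale_prod algebra_simps l.add l.scale r.add r.scale
       acts' bracket_self mi zero_prod_def J split: prod.splits)
qed

section \<open>Alternating multilinear maps\<close>

definition fun_scale :: "(complex \<Rightarrow> 'v \<Rightarrow> 'v) \<Rightarrow> complex \<Rightarrow> ('x \<Rightarrow> 'v) \<Rightarrow> 'x \<Rightarrow> 'v"
  where "fun_scale s c f = (\<lambda>x. s c (f x))"

text \<open>A map of \<open>k\<close> arguments is a function on lists that vanishes off the lists of length \<open>k\<close>.
  In degree 0 the map is determined by its arbitrary value at \<open>[]\<close>.\<close>

definition alt_maps ::
  "(complex \<Rightarrow> 'a::ab_group_add \<Rightarrow> 'a) \<Rightarrow> (complex \<Rightarrow> 'v::ab_group_add \<Rightarrow> 'v) \<Rightarrow> 'v set \<Rightarrow> nat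
    \<Rightarrow> ('a list \<Rightarrow> 'v) set"
  where "alt_maps s t W k = {f.
    (\<forall>xs. length xs \<noteq> k \<longrightarrow> f xs = 0) \<and>
    (\<forall>xs. length xs = k \<longrightarrow> f xs \<in> W) \<and>
    (\<forall>xs i. length xs = k \<longrightarrow> i < k \<longrightarrow> Vector_Spaces.linear s t (\<lambda>x. f (xs[i := x]))) \<and>
    (\<forall>xs i j. length xs = k \<longrightarrow> i < j \<longrightarrow> j < k \<longrightarrow> xs ! i = xs ! j \<longrightarrow> f xs = 0)}"

text \<open>The module \<open>Hom(\<And>\<^sup>l M, \<complex>)\<close>, again for a module \<open>M\<close> that is a whole type.\<close>

definition alt_forms ::
  "nat \<Rightarrow> ('a, 'm::ab_group_add) lie_mod \<Rightarrow> ('a, 'm list \<Rightarrow> complex) lie_mod"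
  where "alt_forms l M =
    \<lparr>mcarrier = alt_maps (mscale M) (*) UNIV l,
     mscale = fun_scale (*),
     mact = (\<lambda>x f vs. - (\<Sum>i<length vs. f (vs[i := mact M x (vs ! i)])))\<rparr>"

lemma alt_forms_lie_module:
  fixes M :: "('a::ab_group_add, 'm::ab_group_add) lie_mod"
  assumes "lie_module \<gg> M" "mcarrier M = UNIV"
  shows "lie_module \<gg> (alt_forms l M)"
proof -
  interpret lie_module \<gg> M by fact
  interpret g: vector_space "lscale \<gg>" by (rule vector_space)
  interpret m: vector_space "mscale M" by (rule mod_vector_space)
  have vc: "vector_space ((*) :: complex \<Rightarrow> _)"
    by unfold_locales (auto simp: algebra_simps)
  have vs: "vector_space (fun_scale ((*) :: complex \<Rightarrow> _ \<Rightarrow> _) :: _ \<Rightarrow> ('m list \<Rightarrow> complex) \<Rightarrow> _)" (is "vector_space ?s")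
    by (rule vector_space.intro) (simp_all add: fun_scale_def fun_eq_iff distrib_left distrib_right mult.assoc)
  interpret s: vector_space ?s by (rule vs)
  note acts = act_add_left act_add_right act_scale_left act_scale_right act_bracket
  note acts' = acts[unfolded assms(2), simplified]
  let ?A = "alt_maps (mscale M) ((*) :: complex \<Rightarrow> _) UNIV l"
  let ?a = "mact (alt_forms l M)"
  have lin: "Vector_Spaces.linear (mscale M) (*) (\<lambda>v. f (vs[i := v]))"
    if "f \<in> ?A" "length vs = l" "i < l" for f vs i
    using that unfolding alt_maps_def by blast
  have zero: "f vs = 0" if "f \<in> ?A" "length vs \<noteq> l" for f vs
    using that unfolding alt_maps_def by blast
  have alt: "f vs = 0" if "f \<in> ?A" "length vs = l" "i < j" "j < l" "vs ! i = vs ! j" for f vs i j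
    using that unfolding alt_maps_def by blast
  have lin_add: "f (vs[i := v + w]) = f (vs[i := v]) + f (vs[i := w])"
    and lin_scale: "f (vs[i := mscale M c v]) = c * f (vs[i := v])"
    if "f \<in> ?A" "length vs = l" "i < l" for f vs i v w c
    using lin[OF that] unfolding Vector_Spaces.linear_iff by auto
  have lin_diff: "f (vs[i := v - w]) = f (vs[i := v]) - f (vs[i := w])"
    if "f \<in> ?A" "length vs = l" "i < l" for f vs i v w
    using lin_add[OF that, of "v - w" w] by simp
  have a: "?a x f vs = - (\<Sum>p<length vs. f (vs[p := mact M x (vs ! p)]))" for x f vs
    by (simp add: alt_forms_def)
  have sub: "s.subspace ?A"
    unfolding s.subspace_def alt_maps_def Vector_Spaces.linear_iff
    by (auto simp: fun_scale_def vc mod_vector_space algebra_simps)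
  have closed: "?a x f \<in> ?A" if f: "f \<in> ?A" for x f
    unfolding alt_maps_def mem_Collect_eq
  proof (intro conjI allI impI)
    show "?a x f vs = 0" if "length vs \<noteq> l" for vs
      using that f by (simp add: a zero)
    show "?a x f vs \<in> UNIV" for vs by simp
    show "Vector_Spaces.linear (mscale M) (*) (\<lambda>v. ?a x f (vs[i := v]))"
      if l: "length vs = l" and i: "i < l" for vs i
    proof -
      have *: "Vector_Spaces.linear (mscale M) (*) (\<lambda>v. f ((vs[i := v])[p := mact M x (vs[i := v] ! p)]))"
        if p: "p < l" for p
      proof (cases "p = i")
        case True
        then show ?thesis
          using l i f unfolding Vector_Spaces.linear_iff by (simp add: vc mod_vector_space acts' lin_add lin_scale)
      next
        case False
        then have "(\<lambda>v. f ((vs[i := v])[p := mact M x (vs[i := v] ! p)])) =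
            (\<lambda>v. f ((vs[p := mact M x (vs ! p)])[i := v]))"
          by (simp add: list_update_swap[of i p])
        then show ?thesis using lin[OF f, of "vs[p := mact M x (vs ! p)]" i] l i by simp
      qed
      have "?a x f (vs[i := v + w]) = ?a x f (vs[i := v]) + ?a x f (vs[i := w])" for v w
        using * l unfolding Vector_Spaces.linear_iff a by (simp add: sum.distrib)
      moreover have "?a x f (vs[i := mscale M c v]) = c * ?a x f (vs[i := v])" for c v
        using * l unfolding Vector_Spaces.linear_iff a by (simp add: sum_distrib_left)
      ultimately show ?thesis unfolding Vector_Spaces.linear_iff using vc mod_vector_space by simp
    qed
    show "?a x f vs = 0"
      if l: "length vs = l" and ij: "i < j" "j < l" and eq: "vs ! i = vs ! j" for vs i j
    proof -
      let ?F = "\<lambda>p. f (vs[p := mact M x (vs ! p)])"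
      let ?G = "\<lambda>u v. f (vs[i := u, j := v])"
      let ?u = "mact M x (vs ! i)" let ?v = "vs ! i"
      have "(\<Sum>p<l. ?F p) = (\<Sum>p\<in>{i, j}. ?F p)"
      proof (rule sum.mono_neutral_right)
        show "\<forall>p\<in>{..<l} - {i, j}. ?F p = 0"
        proof
          fix p assume "p \<in> {..<l} - {i, j}"
          then show "?F p = 0"
            by (intro alt[OF f _ ij]) (simp_all add: l eq)
        qed
      qed (use ij in auto)
      also have "\<dots> = ?F i + ?F j" using ij by simp
      also have "?F i = ?G ?u ?v"
      proof -
        have "vs[j := ?v] = vs" by (metis eq list_update_id)
        then show ?thesis using ij by (simp add: list_update_swap[of i j])
      qed
      also have "?F j = ?G ?v ?u" by (simp only: list_update_id eq[symmetric])
      also have "?G ?u ?v + ?G ?v ?u = ?G (?u + ?v) (?u + ?v)"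
      proof -
        have G1: "?G (p + q) w = ?G p w + ?G q w" for p q w
          using lin_add[OF f, of "vs[j := w]" i p q] l ij by (simp add: list_update_swap[of j i])
        have G2: "?G w (p + q) = ?G w p + ?G w q" for p q w
          using lin_add[OF f, of "vs[i := w]" j p q] l ij by simp
        have G3: "?G w w = 0" for w
          by (rule alt[OF f _ ij]) (use l ij in simp_all)
        show ?thesis unfolding G1 G2 using G3[of ?u] G3[of ?v] by (simp only: add_0_left add_0_right add.commute)
      qed
      also have "\<dots> = 0"
        by (rule alt[OF f _ ij]) (use l ij in simp_all)
      finally show ?thesis using l by (simp add: a)
    qed
  qed
  have bracket: "?a (lbracket \<gg> x y) f = ?a x (?a y f) - ?a y (?a x f)" if f: "f \<in> ?A" for x y f
  proof (rule ext)
    fix vs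
    show "?a (lbracket \<gg> x y) f vs = (?a x (?a y f) - ?a y (?a x f)) vs"
    proof (cases "length vs = l")
      case False
      then show ?thesis using f by (simp add: a zero)
    next
      case l: True
      define D where "D x y p q = f (vs[p := mact M x (vs ! p), q := mact M y (vs[p := mact M x (vs ! p)] ! q)])"
        for x y p q
      have aa: "?a x (?a y f) vs = (\<Sum>p<l. \<Sum>q<l. D x y p q)" for x y
        by (simp add: a l sum_negf D_def)
      have swap: "D x y p q = D y x q p" if "p \<noteq> q" for p q
        using that by (simp add: D_def list_update_swap[of p q])
      have diag: "D x y p p = f (vs[p := mact M y (mact M x (vs ! p))])" if "p < l" for p x y
        using that l by (simp add: D_def)
      have "?a y (?a x f) vs = (\<Sum>p<l. \<Sum>q<l. D y x q p)"
        unfolding aa by (rule sum.swap)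
      then have "?a x (?a y f) vs - ?a y (?a x f) vs = (\<Sum>p<l. \<Sum>q<l. D x y p q - D y x q p)"
        by (simp add: aa sum_subtractf)
      also have "\<dots> = (\<Sum>p<l. \<Sum>q<l. if q = p then D x y p p - D y x p p else 0)"
        by (intro sum.cong refl) (auto simp: swap)
      also have "\<dots> = (\<Sum>p<l. D x y p p - D y x p p)" by simp
      also have "\<dots> = ?a (lbracket \<gg> x y) f vs"
        using l f by (simp add: a diag acts' lin_diff sum_subtractf)
      finally show ?thesis by simp
    qed
  qed
  have left: "?a (x + y) f = ?a x f + ?a y f" "?a (lscale \<gg> c x) f = ?s c (?a x f)" if f: "f \<in> ?A" for x y f c
  proof -
    show "?a (x + y) f = ?a x f + ?a y f"
    proof
      fix vs show "?a (x + y) f vs = (?a x f + ?a y f) vs"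
        by (cases "length vs = l") (simp_all add: a f zero acts' lin_add sum.distrib)
    qed
    show "?a (lscale \<gg> c x) f = ?s c (?a x f)"
    proof
      fix vs show "?a (lscale \<gg> c x) f vs = ?s c (?a x f) vs"
        by (cases "length vs = l")
          (simp_all add: a f zero acts' lin_scale sum_distrib_left fun_scale_def)
    qed
  qed
  have right: "?a x (f + h) = ?a x f + ?a x h" "?a x (?s c f) = ?s c (?a x f)" for x f h c
    by (auto simp: fun_eq_iff a fun_scale_def sum.distrib sum_distrib_left)
  have car: "mcarrier (alt_forms l M) = ?A" "mscale (alt_forms l M) = ?s"
    by (simp_all add: alt_forms_def)
  show ?thesis
    using vs sub closed bracket left right
    by (intro lie_module.intro lie_module_axioms.intro lie_algebra_axioms) (simp_all add: car)
qed

section \<open>Chevalley--Eilenberg cohomology\<close>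

definition cochains ::
  "nat \<Rightarrow> 'a::ab_group_add lie_alg \<Rightarrow> ('a, 'v::ab_group_add) lie_mod \<Rightarrow> ('a list \<Rightarrow> 'v) set"
  where "cochains k \<gg> N = alt_maps (lscale \<gg>) (mscale N) (mcarrier N) k"

text \<open>Arguments are numbered from 0, and \<open>nths xs (- {i})\<close> omits the argument \<open>xs ! i\<close>.\<close>

definition ce_diff ::
  "nat \<Rightarrow> 'a::ab_group_add lie_alg \<Rightarrow> ('a, 'v::ab_group_add) lie_mod
    \<Rightarrow> ('a list \<Rightarrow> 'v) \<Rightarrow> 'a list \<Rightarrow> 'v"
  where "ce_diff k \<gg> N f = (\<lambda>xs. if length xs = Suc k then
      (\<Sum>i\<le>k. mscale N ((-1) ^ i) (mact N (xs ! i) (f (nths xs (- {i}))))) +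
      (\<Sum>j\<le>k. \<Sum>i<j. mscale N ((-1) ^ (i + j))
        (f (lbracket \<gg> (xs ! i) (xs ! j) # nths xs (- {i, j}))))
    else 0)"

definition cocycles ::
  "nat \<Rightarrow> 'a::ab_group_add lie_alg \<Rightarrow> ('a, 'v::ab_group_add) lie_mod \<Rightarrow> ('a list \<Rightarrow> 'v) set"
  where "cocycles k \<gg> N = {f \<in> cochains k \<gg> N. ce_diff k \<gg> N f = 0}"

fun coboundaries ::
  "nat \<Rightarrow> 'a::ab_group_add lie_alg \<Rightarrow> ('a, 'v::ab_group_add) lie_mod \<Rightarrow> ('a list \<Rightarrow> 'v) set"
  where
    "coboundaries 0 \<gg> N = {0}"
  | "coboundaries (Suc k) \<gg> N = ce_diff k \<gg> N ` cochains k \<gg> N"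

record 'v cvspace =
  vcarrier :: "'v set"
  vadd :: "'v \<Rightarrow> 'v \<Rightarrow> 'v"
  vscale :: "complex \<Rightarrow> 'v \<Rightarrow> 'v"

text \<open>The vectors of \<open>Z / B\<close> are the cosets \<open>z + B\<close>. In \<open>vscale\<close> the summand \<open>B\<close> matters only for
  the scalar 0.\<close>

definition quotient_space ::
  "(complex \<Rightarrow> 'v::ab_group_add \<Rightarrow> 'v) \<Rightarrow> 'v set \<Rightarrow> 'v set \<Rightarrow> 'v set cvspace"
  where "quotient_space s Z B =
    \<lparr>vcarrier = (\<lambda>z. z +o B) ` Z, vadd = (+), vscale = (\<lambda>c X. s c ` X + B)\<rparr>"

definition ce_cohomology ::
  "nat \<Rightarrow> 'a::ab_group_add lie_alg \<Rightarrow> ('a, 'v::ab_group_add) lie_mod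
    \<Rightarrow> ('a list \<Rightarrow> 'v) set cvspace"
  where "ce_cohomology k \<gg> N =
    quotient_space (fun_scale (mscale N)) (cocycles k \<gg> N) (coboundaries k \<gg> N)"

text \<open>For a finite index set the direct sum is the full product.\<close>

definition finite_direct_sum :: "'i set \<Rightarrow> ('i \<Rightarrow> 'v cvspace) \<Rightarrow> ('i \<Rightarrow> 'v) cvspace"
  where "finite_direct_sum I V =
    \<lparr>vcarrier = (\<Pi>\<^sub>E i\<in>I. vcarrier (V i)),
     vadd = (\<lambda>f g. \<lambda>i\<in>I. vadd (V i) (f i) (g i)),
     vscale = (\<lambda>c f. \<lambda>i\<in>I. vscale (V i) c (f i))\<rparr>"

definition cvspace_isomorphic :: "'v cvspace \<Rightarrow> 'w cvspace \<Rightarrow> bool"  (infix \<open>\<cong>\<^sub>\<complex>\<close> 50)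
  where "V \<cong>\<^sub>\<complex> W \<longleftrightarrow> (\<exists>\<phi>. bij_betw \<phi> (vcarrier V) (vcarrier W) \<and>
    (\<forall>x\<in>vcarrier V. \<forall>y\<in>vcarrier V. \<phi> (vadd V x y) = vadd W (\<phi> x) (\<phi> y)) \<and>
    (\<forall>c. \<forall>x\<in>vcarrier V. \<phi> (vscale V c x) = vscale W c (\<phi> x)))"

end

theory Submission
  imports Defs
begin

text \<open>Write \<open>\<hh>\<close> for the semidirect sum. An alternating form on \<open>\<gg> \<times> M\<close> of degree \<open>n\<close> is determined by its
  values on arguments that each lie in one summand, and because it is alternating the arguments from
  \<open>\<gg>\<close> may be put first. So \<open>f\<close> amounts to its components \<open>f\<^sub>k (x\<^sub>1, \<dots>, x\<^sub>k) (v\<^sub>1, \<dots>, v\<^sub>l)\<close> with \<open>k + l = n\<close>,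
  and \<open>f\<^sub>k\<close> is a \<open>k\<close>-cochain of \<open>\<gg>\<close> with values in the alternating \<open>l\<close>-forms on \<open>M\<close>
  (\<open>component_cochain\<close>). Every family of such cochains occurs: the inverse map is a signed sum over
  shuffles (\<open>components_surjective\<close>, \<open>component_eq_zero_imp\<close>).

  The differential respects this splitting. In \<open>d f\<close> a pair of arguments from \<open>\<gg>\<close> gives the bracket
  terms of the differential of \<open>\<gg>\<close>; a mixed pair \<open>x, v\<close> gives \<open>[x, v] = x \<cdot> v\<close>, which is the action of
  \<open>x\<close> on the forms on \<open>M\<close>; a pair from \<open>M\<close> gives 0 because \<open>M\<close> is abelian. Hence
  \<open>(d f)\<^sub>k\<^sub>+\<^sub>1 = d (f\<^sub>k)\<close> with the number \<open>l\<close> of arguments from \<open>M\<close> unchanged, and \<open>(d f)\<^sub>0 = 0\<close>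
  (\<open>component_Suc_ce_diff\<close>, \<open>component_0_ce_diff\<close>). So the cochain complex of \<open>\<hh>\<close> is the direct sum of
  the complexes of \<open>\<gg>\<close> with coefficients in the forms of degree \<open>l\<close>, shifted by \<open>l\<close>, and the
  cohomology splits in the same way.

  The sums over positions in the differential and over shuffles are replaced by recursions on the
  list of arguments. For the differential the recursion is Cartan's formula
  \<open>\<iota>\<^sub>x d + d \<iota>\<^sub>x = L\<^sub>x\<close>, where \<open>\<iota>\<^sub>x\<close> inserts \<open>x\<close> as first argument and \<open>L\<^sub>x\<close> is the Lie derivative.
  The remaining signs come from exchanging two neighbouring arguments.\<close>

section \<open>Alternating maps on lists\<close>

text \<open>There is no fixed number of arguments here, so that inserting a first argument preserves the
  notion, which makes induction on the list of arguments possible. It suffices to ask for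
  equal neighbours: see \<open>alternating_repeated\<close>.\<close>

definition alternating ::
  "(complex \<Rightarrow> 'a::ab_group_add \<Rightarrow> 'a) \<Rightarrow> (complex \<Rightarrow> 'v::ab_group_add \<Rightarrow> 'v) \<Rightarrow> ('a list \<Rightarrow> 'v) \<Rightarrow> bool"
  where "alternating s t F \<longleftrightarrow>
    (\<forall>xs c x y ys. F (xs @ (s c x + y) # ys) = t c (F (xs @ x # ys)) + F (xs @ y # ys)) \<and>
    (\<forall>xs x ys. F (xs @ x # x # ys) = 0)"

lemma alternating_linear:
  "alternating s t F \<Longrightarrow> F (xs @ (s c x + y) # ys) = t c (F (xs @ x # ys)) + F (xs @ y # ys)"
  by (simp add: alternating_def)

lemma alternating_adjacent: "alternating s t F \<Longrightarrow> F (xs @ x # x # ys) = 0"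
  by (simp add: alternating_def)

lemma alternating_prefix: "alternating s t F \<Longrightarrow> alternating s t (\<lambda>ys. F (us @ ys))"
  unfolding alternating_def by (metis append.assoc)

lemma alternating_Cons: "alternating s t F \<Longrightarrow> alternating s t (\<lambda>ys. F (x # ys))"
  using alternating_prefix[of s t F "[x]"] by simp

context
  fixes s :: "complex \<Rightarrow> 'a::ab_group_add \<Rightarrow> 'a" and t :: "complex \<Rightarrow> 'v::ab_group_add \<Rightarrow> 'v"
    and F :: "'a list \<Rightarrow> 'v"
  assumes s: "vector_space s" and t: "vector_space t" and F: "alternating s t F"
begin

interpretation s: vector_space s by (rule s)
interpretation t: vector_space t by (rule t)

lemma alternating_add: "F (xs @ (x + y) # ys) = F (xs @ x # ys) + F (xs @ y # ys)"
  using alternating_linear[OF F, of xs 1 x y ys] by simp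

lemma alternating_zero: "F (xs @ 0 # ys) = 0"
  using alternating_add[of xs 0 0 ys] by simp

lemma alternating_scale: "F (xs @ s c x # ys) = t c (F (xs @ x # ys))"
  using alternating_linear[OF F, of xs c x 0 ys] by (simp add: alternating_zero)

lemma alternating_swap: "F (xs @ x # y # ys) = - F (xs @ y # x # ys)"
proof -
  have "0 = F (xs @ (x + y) # (x + y) # ys)"
    by (simp add: alternating_adjacent[OF F])
  also have "\<dots> = F (xs @ x # (x + y) # ys) + F (xs @ y # (x + y) # ys)"
    by (rule alternating_add)
  also have "\<dots> = F (xs @ x # y # ys) + F (xs @ y # x # ys)"
    using alternating_add[of "xs @ [x]" x y ys] alternating_add[of "xs @ [y]" x y ys]
    by (simp add: alternating_adjacent[OF F])
  finally show ?thesis by (simp add: eq_neg_iff_add_eq_0)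
qed

text \<open>Moving \<open>x\<close> behind \<open>ys\<close> takes one exchange of neighbours for each element of \<open>ys\<close>.\<close>

lemma alternating_move: "F (us @ x # ys @ zs) = t ((-1) ^ length ys) (F (us @ ys @ x # zs))"
proof (induction ys arbitrary: us)
  case (Cons y ys)
  show ?case
    using alternating_swap[of us x y "ys @ zs"] Cons.IH[of "us @ [y]"]
    by (simp add: t.scale_minus_left)
qed simp

lemma alternating_repeated: "F (xs @ x # ys @ x # zs) = 0"
  using alternating_move[of xs x ys "x # zs"] alternating_adjacent[OF F, of "xs @ ys" x zs] by simp

end

lemma alt_maps_iff_alternating:
  assumes s: "vector_space s" and t: "vector_space t"
  shows "F \<in> alt_maps s t W k \<longleftrightarrow>
    (\<forall>xs. length xs \<noteq> k \<longrightarrow> F xs = 0) \<and> (\<forall>xs. length xs = k \<longrightarrow> F xs \<in> W) \<and> alternating s t F"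
    (is "?L \<longleftrightarrow> ?R")
proof
  interpret t: vector_space t by (rule t)
  assume L: ?L
  have zero: "F xs = 0" if "length xs \<noteq> k" for xs
    using that L unfolding alt_maps_def by blast
  have linear: "Vector_Spaces.linear s t (\<lambda>x. F (xs[i := x]))" if "length xs = k" "i < k" for xs i
    using that L unfolding alt_maps_def by blast
  have repeated: "F xs = 0" if "length xs = k" "i < j" "j < k" "xs ! i = xs ! j" for xs i j
    using that L unfolding alt_maps_def by blast
  have "F (xs @ (s c x + y) # ys) = t c (F (xs @ x # ys)) + F (xs @ y # ys)" for xs c x y ys
  proof (cases "length (xs @ x # ys) = k")
    case True
    then show ?thesis
      using linear[of "xs @ x # ys" "length xs"] by (simp add: Vector_Spaces.linear_iff)
  next
    case False
    then show ?thesis by (simp add: zero)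
  qed
  moreover have "F (xs @ x # x # ys) = 0" for xs x ys
  proof (cases "length (xs @ x # x # ys) = k")
    case True
    then show ?thesis
      using repeated[of "xs @ x # x # ys" "length xs" "Suc (length xs)"] by (simp add: nth_append)
  qed (rule zero)
  ultimately show ?R using L by (simp add: alternating_def alt_maps_def)
next
  assume R: ?R
  then have F: "alternating s t F" by simp
  have "Vector_Spaces.linear s t (\<lambda>x. F (xs[i := x]))" if "i < length xs" for xs i
    unfolding Vector_Spaces.linear_iff using that s t
    by (simp add: upd_conv_take_nth_drop alternating_add[OF s t F] alternating_scale[OF s t F])
  moreover have "F xs = 0" if ij: "i < j" "j < length xs" and eq: "xs ! i = xs ! j" for xs i j
  proof -
    have "drop (Suc i) xs = take (j - Suc i) (drop (Suc i) xs) @ xs ! j # drop (Suc j) xs"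
      using id_take_nth_drop[of "j - Suc i" "drop (Suc i) xs"] ij by simp
    then have "xs = take i xs @ xs ! i # take (j - Suc i) (drop (Suc i) xs) @ xs ! i # drop (Suc j) xs"
      using id_take_nth_drop[of i xs] ij eq by simp
    then have "F xs = F (take i xs @ xs ! i # take (j - Suc i) (drop (Suc i) xs) @ xs ! i # drop (Suc j) xs)"
      by (rule arg_cong)
    also have "\<dots> = 0" by (rule alternating_repeated[OF s t F])
    finally show ?thesis .
  qed
  ultimately show ?L using R by (simp add: alt_maps_def)
qed

section \<open>Leibniz sums and the Cartan recursion\<close>

text \<open>The extension of \<open>b\<close> to a derivation. For \<open>b = [x, \<cdot>]\<close> the Lie derivative of \<open>F\<close> is
  \<open>L\<^sub>x F = x \<cdot> F - leibniz_sum b F\<close>.\<close>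

definition leibniz_sum :: "('a \<Rightarrow> 'a) \<Rightarrow> ('a list \<Rightarrow> 'v::ab_group_add) \<Rightarrow> 'a list \<Rightarrow> 'v"
  where "leibniz_sum b F xs = (\<Sum>q<length xs. F (xs[q := b (xs ! q)]))"

lemma leibniz_sum_Nil [simp]: "leibniz_sum b F [] = 0"
  by (simp add: leibniz_sum_def)

lemma leibniz_sum_Cons [simp]:
  "leibniz_sum b F (x # xs) = F (b x # xs) + leibniz_sum b (\<lambda>ys. F (x # ys)) xs"
  unfolding leibniz_sum_def length_Cons sum.lessThan_Suc_shift by simp

lemma leibniz_sum_append:
  "leibniz_sum b F (xs @ ys) =
    leibniz_sum b (\<lambda>us. F (us @ ys)) xs + leibniz_sum b (\<lambda>us. F (xs @ us)) ys"
  by (induction xs arbitrary: F) (simp_all add: add.assoc)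

lemma leibniz_sum_map:
  "(\<And>x. b (h x) = h (b' x)) \<Longrightarrow>
    leibniz_sum b F (map h xs) = leibniz_sum b' (\<lambda>us. F (map h us)) xs"
  by (induction xs arbitrary: F) simp_all

lemma leibniz_sum_cong:
  "(\<And>us. length us = length xs \<Longrightarrow> F us = F' us) \<Longrightarrow> leibniz_sum b F xs = leibniz_sum b F' xs"
  by (simp add: leibniz_sum_def)

lemma leibniz_sum_zero [simp]: "leibniz_sum b (\<lambda>xs. 0) xs = 0"
  by (simp add: leibniz_sum_def)

lemma leibniz_sum_linear:
  assumes "vector_space t"
  shows "leibniz_sum b (\<lambda>us. t c (F us) + F' us) xs = t c (leibniz_sum b F xs) + leibniz_sum b F' xs"
proof -
  interpret vector_space t by fact
  show ?thesis by (simp add: leibniz_sum_def sum.distrib scale_sum_right)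
qed

lemma leibniz_sum_apply: "leibniz_sum b F xs vs = leibniz_sum b (\<lambda>us. F us vs) xs"
  by (induction xs arbitrary: F) simp_all

text \<open>For two equal neighbours \<open>x, x\<close> all terms vanish except those with \<open>b x, x\<close> and \<open>x, b x\<close> in
  their place, and these cancel.\<close>

lemma leibniz_sum_alternating:
  assumes s: "vector_space s" and t: "vector_space t" and F: "alternating s t F"
    and b: "\<And>c x y. b (s c x + y) = s c (b x) + b y"
  shows "alternating s t (leibniz_sum b F)"
proof -
  interpret t: vector_space t by (rule t)
  have lin: "leibniz_sum b F (xs @ (s c x + y) # ys) =
      t c (leibniz_sum b F (xs @ x # ys)) + leibniz_sum b F (xs @ y # ys)"
    if "alternating s t F" for F xs c x y ys
    using that
  proof (induction xs arbitrary: F)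
    case Nil
    show ?case
      using alternating_linear[OF Nil, of "[]"]
      by (simp add: b leibniz_sum_linear[OF t] t.scale_right_distrib)
  next
    case (Cons u us)
    show ?case
      using Cons.IH[OF alternating_Cons[OF Cons.prems]] alternating_linear[OF Cons.prems, of "b u # us"]
      by (simp add: t.scale_right_distrib)
  qed
  have adj: "leibniz_sum b F (xs @ x # x # ys) = 0" if "alternating s t F" for F xs x ys
    using that
  proof (induction xs arbitrary: F)
    case Nil
    show ?case
      using alternating_swap[OF s t Nil, of "[]" "b x" x ys] alternating_adjacent[OF Nil, of "[]"]
      by simp
  next
    case (Cons u us)
    show ?case
      using Cons.IH[OF alternating_Cons[OF Cons.prems]] alternating_adjacent[OF Cons.prems, of "b u # us"]
      by simp
  qed
  show ?thesis unfolding alternating_def using lin[OF F] adj[OF F] by blast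
qed

text \<open>Cartan's formula \<open>\<iota>\<^sub>x (d F) = L\<^sub>x F - d (\<iota>\<^sub>x F)\<close> read as a definition of \<open>d\<close>. On the empty list
  every \<open>d F\<close> vanishes because \<open>d F\<close> has positive degree.\<close>

fun cartan_diff ::
  "'a::ab_group_add lie_alg \<Rightarrow> ('a, 'v::ab_group_add) lie_mod \<Rightarrow> ('a list \<Rightarrow> 'v) \<Rightarrow> 'a list \<Rightarrow> 'v"
  where
    "cartan_diff \<gg> N F [] = 0"
  | "cartan_diff \<gg> N F (x # xs) =
      mact N x (F xs) - leibniz_sum (lbracket \<gg> x) F xs - cartan_diff \<gg> N (\<lambda>ys. F (x # ys)) xs"

lemma cartan_diff_cong:
  "(\<And>us. Suc (length us) = length xs \<Longrightarrow> F us = F' us) \<Longrightarrow> cartan_diff \<gg> N F xs = cartan_diff \<gg> N F' xs"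
proof (induction xs arbitrary: F F')
  case (Cons x xs)
  have "cartan_diff \<gg> N (\<lambda>ys. F (x # ys)) xs = cartan_diff \<gg> N (\<lambda>ys. F' (x # ys)) xs"
    by (rule Cons.IH) (simp add: Cons.prems)
  moreover have "leibniz_sum (lbracket \<gg> x) F xs = leibniz_sum (lbracket \<gg> x) F' xs"
    by (rule leibniz_sum_cong) (simp add: Cons.prems)
  ultimately show ?case by (simp add: Cons.prems)
qed simp

lemma nths_omit: "nths xs (- {i}) = take i xs @ drop (Suc i) xs"
proof (induction xs arbitrary: i)
  case (Cons x xs)
  have "{j. Suc j \<in> - {i}} = (case i of 0 \<Rightarrow> UNIV | Suc i' \<Rightarrow> - {i'})"
    by (auto split: nat.split)
  then show ?case using Cons by (cases i) (simp_all add: nths_Cons nths_all)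
qed simp

text \<open>The terms of the differential that single out the first argument \<open>x\<close> are \<open>x \<cdot> F\<close> and, once each bracket
  \<open>[x, x\<^sub>j]\<close> is moved from the front to the place of \<open>x\<^sub>j\<close>, the Leibniz sum. The other terms are those of
  \<open>\<iota>\<^sub>x F\<close> with all indices raised by one: this gives one sign in the action terms, and in
  the bracket terms, where two indices are raised, the sign comes from exchanging the bracket with \<open>x\<close>.\<close>

lemma ce_diff_eq_cartan_diff:
  assumes s: "vector_space (lscale \<gg>)" and t: "vector_space (mscale N)"
    and F: "alternating (lscale \<gg>) (mscale N) F"
  shows "ce_diff k \<gg> N F xs = (if length xs = Suc k then cartan_diff \<gg> N F xs else 0)"
proof -
  interpret t: vector_space "mscale N" by (rule t)
  let ?t = "\<lambda>n::nat. mscale N ((-1) ^ n)"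
  \<comment> \<open>the two sums of the differential, taken over the positions of the list so that no degree is fixed\<close>
  define A where "A F xs = (\<Sum>i<length xs. ?t i (mact N (xs ! i) (F (nths xs (- {i})))))"
    for F :: "'a list \<Rightarrow> 'b" and xs
  define B where "B F xs = (\<Sum>j<length xs. \<Sum>i<j. ?t (i + j)
      (F (lbracket \<gg> (xs ! i) (xs ! j) # nths xs (- {i, j}))))"
    for F :: "'a list \<Rightarrow> 'b" and xs
  have n1: "nths (x # xs) (- {Suc i}) = x # nths xs (- {i})"
    and n2: "nths (x # xs) (- {0, Suc i}) = nths xs (- {i})"
    and n3: "nths (x # xs) (- {Suc i, Suc j}) = x # nths xs (- {i, j})" for x :: 'a and xs i j
  proof -
    have "{j. Suc j \<in> - {Suc i}} = - {i}" "{j. Suc j \<in> - {0, Suc i}} = - {i}"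
      "{k. Suc k \<in> - {Suc i, Suc j}} = - {i, j}" by auto
    then show "nths (x # xs) (- {Suc i}) = x # nths xs (- {i})"
      "nths (x # xs) (- {0, Suc i}) = nths xs (- {i})"
      "nths (x # xs) (- {Suc i, Suc j}) = x # nths xs (- {i, j})"
      by (simp_all add: nths_Cons)
  qed
  have "A F xs + B F xs = cartan_diff \<gg> N F xs" if "alternating (lscale \<gg>) (mscale N) F" for F
    using that
  proof (induction xs arbitrary: F)
    case Nil
    show ?case by (simp add: A_def B_def)
  next
    case (Cons x xs)
    note alt = Cons.prems
    let ?G = "\<lambda>ys. F (x # ys)"
    have "A F (x # xs) = mact N x (F xs) + (\<Sum>i<length xs. - ?t i (mact N (xs ! i) (?G (nths xs (- {i})))))"
      unfolding A_def length_Cons sum.lessThan_Suc_shift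
      by (simp add: nths_omit[of "x # xs" 0] n1)
    then have a: "A F (x # xs) = mact N x (F xs) - A ?G xs"
      by (simp add: A_def sum_negf)
    \<comment> \<open>pairs that contain the first argument\<close>
    have m: "?t (Suc j) (F (b # nths xs (- {j}))) = - F (xs[j := b])" if "j < length xs" for j b
      using that alternating_move[OF s t alt, of "[]" b "take j xs" "drop (Suc j) xs"]
      by (simp add: nths_omit upd_conv_take_nth_drop t.scale_minus_left flip: power_add)
    \<comment> \<open>pairs that do not\<close>
    have p: "?t (i + j) (F (b # x # ys)) = - ?t (i + j) (?G (b # ys))" for i j b ys
      using alternating_swap[OF s t alt, of "[]" b x ys] by (simp add: t.scale_minus_right)
    have "B F (x # xs) = (\<Sum>j<length xs. ?t (Suc j) (F (lbracket \<gg> x (xs ! j) # nths xs (- {j}))) +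
        (\<Sum>i<j. ?t (i + j) (F (lbracket \<gg> (xs ! i) (xs ! j) # x # nths xs (- {i, j})))))"
      unfolding B_def length_Cons sum.lessThan_Suc_shift
      by (simp add: n2 n3 del: sum.lessThan_Suc power_Suc) simp
    also have "\<dots> = - leibniz_sum (lbracket \<gg> x) F xs - B ?G xs"
      by (simp add: m p leibniz_sum_def B_def sum.distrib sum_subtractf sum_negf del: power_Suc)
    finally show ?case
      using Cons.IH[OF alternating_Cons[OF alt], of x, symmetric] a by (simp add: algebra_simps)
  qed
  from this[OF F] show ?thesis
    by (auto simp: ce_diff_def A_def B_def lessThan_Suc_atMost simp del: sum.lessThan_Suc)
qed

lemma lie_bracket_linear:
  assumes "lie_algebra \<gg>"
  shows "lbracket \<gg> (lscale \<gg> c x + y) z = lscale \<gg> c (lbracket \<gg> x z) + lbracket \<gg> y z"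
    and "lbracket \<gg> z (lscale \<gg> c x + y) = lscale \<gg> c (lbracket \<gg> z x) + lbracket \<gg> z y"
proof -
  interpret lie_algebra \<gg> by fact
  show "lbracket \<gg> (lscale \<gg> c x + y) z = lscale \<gg> c (lbracket \<gg> x z) + lbracket \<gg> y z"
    using linear_left[of z] unfolding Vector_Spaces.linear_iff by simp
  show "lbracket \<gg> z (lscale \<gg> c x + y) = lscale \<gg> c (lbracket \<gg> z x) + lbracket \<gg> z y"
    using linear_right[of z] unfolding Vector_Spaces.linear_iff by simp
qed

lemma complex_vector_space: "vector_space ((*) :: complex \<Rightarrow> complex \<Rightarrow> complex)"
  by unfold_locales (auto simp: algebra_simps)

lemma trivial_module_simps [simp]:
  "mcarrier trivial_module = UNIV" "mscale trivial_module = (*)" "mact trivial_module x v = 0"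
  by (simp_all add: trivial_module_def)

lemma cartan_diff_trivial_linear:
  "cartan_diff \<gg> trivial_module (\<lambda>us. c * F us + F' us) xs =
    c * cartan_diff \<gg> trivial_module F xs + cartan_diff \<gg> trivial_module F' xs"
proof (induction xs arbitrary: F F')
  case (Cons x xs)
  show ?case
    using Cons.IH[of "\<lambda>ys. F (x # ys)" "\<lambda>ys. F' (x # ys)"]
      leibniz_sum_linear[OF complex_vector_space, of "lbracket \<gg> x" c F F' xs]
    by (simp add: right_diff_distrib)
qed simp

lemma cartan_diff_trivial_zero [simp]: "cartan_diff \<gg> trivial_module (\<lambda>us. 0) xs = 0"
  using cartan_diff_trivial_linear[of \<gg> 0 "\<lambda>us. 0" "\<lambda>us. 0" xs] by (induction xs) simp_all

text \<open>That a differential is again alternating is needed because vanishing components force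
  an alternating form to vanish, but not an arbitrary one. For equal first arguments the recursion unfolds twice to
  \<open>\<iota>\<^sub>x (L\<^sub>x F) - L\<^sub>x (\<iota>\<^sub>x F) + d (\<iota>\<^sub>x \<iota>\<^sub>x F)\<close>; the first two terms differ by \<open>F ([x, x], \<dots>) = 0\<close> and the last
  is zero.\<close>

lemma cartan_diff_alternating:
  assumes g: "lie_algebra \<gg>" and F: "alternating (lscale \<gg>) (*) F"
  shows "alternating (lscale \<gg>) (*) (cartan_diff \<gg> trivial_module F)"
proof -
  interpret lie_algebra \<gg> by (rule g)
  note vs = vector_space complex_vector_space
  let ?D = "cartan_diff \<gg> trivial_module"
  note br = lie_bracket_linear[OF g]
  have L: "alternating (lscale \<gg>) (*) (leibniz_sum (lbracket \<gg> x) F)"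
    if "alternating (lscale \<gg>) (*) F" for x F
    by (rule leibniz_sum_alternating) (use vs that br(2) in simp_all)
  have lin: "?D F (xs @ (lscale \<gg> c x + y) # ys) = c * ?D F (xs @ x # ys) + ?D F (xs @ y # ys)"
    if "alternating (lscale \<gg>) (*) F" for F xs c x y ys
    using that
  proof (induction xs arbitrary: F)
    case Nil
    have "F (ys[q := lbracket \<gg> (lscale \<gg> c x + y) (ys ! q)]) =
        c * F (ys[q := lbracket \<gg> x (ys ! q)]) + F (ys[q := lbracket \<gg> y (ys ! q)])"
      if "q < length ys" for q
      using that alternating_linear[OF Nil] by (simp add: br upd_conv_take_nth_drop)
    then have "leibniz_sum (lbracket \<gg> (lscale \<gg> c x + y)) F ys =
        c * leibniz_sum (lbracket \<gg> x) F ys + leibniz_sum (lbracket \<gg> y) F ys"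
      by (simp add: leibniz_sum_def sum.distrib sum_distrib_left)
    moreover have "(\<lambda>us. F ((lscale \<gg> c x + y) # us)) = (\<lambda>us. c * F (x # us) + F (y # us))"
      using alternating_linear[OF Nil, of "[]"] by simp
    ultimately show ?case
      by (simp add: cartan_diff_trivial_linear right_diff_distrib)
  next
    case (Cons u us)
    show ?case
      using Cons.IH[OF alternating_Cons[OF Cons.prems]]
        alternating_linear[OF L[OF Cons.prems, of u], of us]
      by (simp add: algebra_simps)
  qed
  have adj: "?D F (xs @ x # x # ys) = 0" if "alternating (lscale \<gg>) (*) F" for F xs x ys
    using that
  proof (induction xs arbitrary: F)
    case Nil
    have "F (x # x # us) = 0" for us
      using alternating_adjacent[OF Nil, of "[]"] by simp
    then show ?case
      using alternating_zero[OF vs Nil, of "[]"] by (simp add: bracket_self)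
  next
    case (Cons u us)
    show ?case
      using Cons.IH[OF alternating_Cons[OF Cons.prems]]
        alternating_adjacent[OF L[OF Cons.prems, of u], of us]
      by simp
  qed
  show ?thesis unfolding alternating_def using lin[OF F] adj[OF F] by blast
qed

section \<open>Splitting the arguments of a cochain\<close>

definition split_args :: "(('g::zero \<times> 'm::zero) list \<Rightarrow> complex) \<Rightarrow> 'g list \<Rightarrow> 'm list \<Rightarrow> complex"
  where "split_args f xs vs = f (map (\<lambda>x. (x, 0)) xs @ map (Pair 0) vs)"

text \<open>A signed sum over shuffles: every argument \<open>(x, v)\<close> contributes either \<open>x\<close> to the first list of \<open>h\<close>
  or \<open>v\<close> to the second. When \<open>v\<close> is chosen, the sign is that of moving it past the elements of \<open>\<gg>\<close>
  chosen later; their number is the length of the first list that \<open>h\<close> receives from the recursive call.\<close>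

fun shuffle :: "('g list \<Rightarrow> 'm list \<Rightarrow> complex) \<Rightarrow> ('g \<times> 'm) list \<Rightarrow> complex"
  where
    "shuffle h [] = h [] []"
  | "shuffle h ((x, v) # zs) =
      shuffle (\<lambda>xs vs. h (x # xs) vs) zs + shuffle (\<lambda>xs vs. (-1) ^ length xs * h xs (v # vs)) zs"

lemma shuffle_linear:
  "shuffle (\<lambda>xs vs. c * h xs vs + h' xs vs) zs = c * shuffle h zs + shuffle h' zs"
proof (induction zs arbitrary: h h')
  case (Cons z zs)
  obtain x v where z: "z = (x, v)" by fastforce
  have "(\<lambda>xs vs. (-1) ^ length xs * (c * h xs (v # vs) + h' xs (v # vs))) =
      (\<lambda>xs vs. c * ((-1) ^ length xs * h xs (v # vs)) + (-1) ^ length xs * h' xs (v # vs))"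
    by (simp add: algebra_simps)
  then show ?case by (simp add: z Cons.IH distrib_left)
qed simp

lemma shuffle_zero [simp]: "shuffle (\<lambda>xs vs. 0) zs = 0"
  by (induction zs) auto

lemma shuffle_minus: "shuffle (\<lambda>xs vs. - h xs vs) zs = - shuffle h zs"
  using shuffle_linear[of "-1" h "\<lambda>xs vs. 0" zs] by simp

text \<open>On arguments that lie in one summand only one choice is nonzero at each position. For the
  arguments from \<open>M\<close>, which come last, no element of \<open>\<gg>\<close> is chosen later, so all signs are 1.\<close>

lemma split_args_shuffle:
  assumes "\<And>xs ys vs. h (xs @ 0 # ys) vs = 0" and "\<And>xs us vs. h xs (us @ 0 # vs) = 0"
  shows "split_args (shuffle h) xs vs = h xs vs"
  using assms
proof (induction xs arbitrary: h)
  case Nil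
  then show ?case
  proof (induction vs arbitrary: h)
    case (Cons v vs)
    have "split_args (shuffle (\<lambda>xs vs. (-1) ^ length xs * h xs (v # vs))) [] vs = h [] (v # vs)"
      using Cons.prems(1) Cons.prems(2)[of _ "v # _"] by (subst Cons.IH) simp_all
    moreover have "h (0 # xs) = (\<lambda>vs. 0)" for xs
      using Cons.prems(1)[of "[]"] by auto
    ultimately show ?case by (simp add: split_args_def)
  qed (simp add: split_args_def)
next
  case (Cons x xs)
  have "split_args (shuffle (\<lambda>xs vs. h (x # xs) vs)) xs vs = h (x # xs) vs"
    using Cons.prems(1)[of "x # _"] Cons.prems(2) by (subst Cons.IH) simp_all
  then show ?case using Cons.prems(2)[of _ "[]"] by (simp add: split_args_def)
qed

abbreviation prod_scale ::
  "(complex \<Rightarrow> 'g::ab_group_add \<Rightarrow> 'g) \<Rightarrow> (complex \<Rightarrow> 'm::ab_group_add \<Rightarrow> 'm) \<Rightarrow>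
    complex \<Rightarrow> 'g \<times> 'm \<Rightarrow> 'g \<times> 'm"
  where "prod_scale \<equiv> module_prod.scale"

context
  fixes s :: "complex \<Rightarrow> 'g::ab_group_add \<Rightarrow> 'g" and m :: "complex \<Rightarrow> 'm::ab_group_add \<Rightarrow> 'm"
  assumes s: "vector_space s" and m: "vector_space m"
begin

interpretation s: vector_space s by (rule s)
interpretation m: vector_space m by (rule m)
interpretation p: vector_space_prod s m ..

lemma vector_space_prod_scale: "vector_space (prod_scale s m)"
  by (rule p.p.vector_space_axioms)

text \<open>Expand each argument as \<open>(x, 0) + (0, v)\<close> and move every \<open>(0, v)\<close> behind the arguments from \<open>\<gg>\<close>.\<close>

lemma shuffle_split_args:
  assumes "alternating (prod_scale s m) (*) f"
  shows "shuffle (split_args f) zs = f zs"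
  using assms
proof (induction zs arbitrary: f)
  case Nil
  show ?case by (simp add: split_args_def)
next
  case (Cons z zs)
  obtain x v where z: "z = (x, v)" by fastforce
  note alt = Cons.prems
  have "f ((0, v) # map (\<lambda>x. (x, 0)) xs @ map (Pair 0) vs) =
      (-1) ^ length xs * f (map (\<lambda>x. (x, 0)) xs @ map (Pair 0) (v # vs))" for xs vs
    using alternating_move[OF vector_space_prod_scale complex_vector_space alt, of "[]" "(0, v)"
        "map (\<lambda>x. (x, 0)) xs" "map (Pair 0) vs"] by simp
  then have "(\<lambda>xs vs. (-1) ^ length xs * split_args f xs (v # vs)) = split_args (\<lambda>ys. f ((0, v) # ys))"
    by (simp add: split_args_def fun_eq_iff)
  moreover have "(\<lambda>xs vs. split_args f (x # xs) vs) = split_args (\<lambda>ys. f ((x, 0) # ys))"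
    by (simp add: split_args_def fun_eq_iff)
  ultimately have "shuffle (split_args f) (z # zs) = f ((x, 0) # zs) + f ((0, v) # zs)"
    using Cons.IH[OF alternating_Cons[OF alt]] by (simp add: z)
  also have "\<dots> = f (z # zs)"
    using alternating_add[OF vector_space_prod_scale complex_vector_space alt, of "[]" "(x, 0)" "(0, v)" zs]
    by (simp add: z)
  finally show ?case .
qed

text \<open>If the first two arguments are both \<open>(x, v)\<close>, the choices \<open>x, x\<close> and \<open>v, v\<close> give 0, and the choices
  \<open>x, v\<close> and \<open>v, x\<close> cancel because in the second one \<open>v\<close> moves past one more element of \<open>\<gg>\<close>.\<close>

lemma shuffle_alternating:
  assumes "\<And>vs. alternating s (*) (\<lambda>xs. h xs vs)" and "\<And>xs. alternating m (*) (h xs)"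
  shows "alternating (prod_scale s m) (*) (shuffle h)"
proof -
  \<comment> \<open>the hypothesis on \<open>h\<close>, in a form that both recursive calls inherit\<close>
  let ?bialt = "\<lambda>h. (\<forall>vs. alternating s (*) (\<lambda>xs. h xs vs)) \<and> (\<forall>xs. alternating m (*) (h xs))"
  have bialt: "?bialt (\<lambda>xs. h (x # xs))" "?bialt (\<lambda>xs vs. (-1) ^ length xs * h xs (v # vs))"
    if "?bialt h" for h x v
  proof -
    show "?bialt (\<lambda>xs. h (x # xs))"
      using that by (auto intro: alternating_Cons)
    have "alternating s (*) (\<lambda>xs. (-1) ^ length xs * h xs vs)" for vs
      using that unfolding alternating_def by (simp add: distrib_left mult.left_commute)
    moreover have "alternating m (*) (\<lambda>vs. (-1) ^ length xs * h xs (v # vs))" for xs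
      using alternating_Cons[of m "(*)" "h xs" v] that
      unfolding alternating_def by (simp add: distrib_left mult.left_commute)
    ultimately show "?bialt (\<lambda>xs vs. (-1) ^ length xs * h xs (v # vs))" by blast
  qed
  have "shuffle h (us @ (prod_scale s m c z + w) # ws) =
      c * shuffle h (us @ z # ws) + shuffle h (us @ w # ws)" if "?bialt h" for h us c z w ws
    using that
  proof (induction us arbitrary: h)
    case Nil
    have "h ((s c x + x') # xs) = (\<lambda>vs. c * h (x # xs) vs + h (x' # xs) vs)" for x x' xs
      using Nil alternating_linear[of s "(*)" "\<lambda>xs. h xs _" "[]"] by auto
    moreover have "(-1) ^ length xs * h xs ((m c v + v') # vs) =
        c * ((-1) ^ length xs * h xs (v # vs)) + (-1) ^ length xs * h xs (v' # vs)" for v v' xs vs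
      using Nil alternating_linear[of m "(*)" "h xs" "[]"] by (simp add: algebra_simps)
    ultimately show ?case
      by (cases z; cases w) (simp add: p.scale_def shuffle_linear distrib_left)
  next
    case (Cons u us)
    show ?case
      using Cons.IH[OF bialt(1)[OF Cons.prems]] Cons.IH[OF bialt(2)[OF Cons.prems]]
      by (cases u) (simp add: algebra_simps)
  qed
  moreover have "shuffle h (us @ z # z # ws) = 0" if "?bialt h" for h us z ws
    using that
  proof (induction us arbitrary: h)
    case Nil
    have "h (x # x # xs) = (\<lambda>vs. 0)" for x xs
      using Nil alternating_adjacent[of s "(*)" "\<lambda>xs. h xs _" "[]"] by auto
    moreover have "h xs (v # v # vs) = 0" for v xs vs
      using Nil alternating_adjacent[of m "(*)" "h xs" "[]"] by simp
    ultimately show ?case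
      by (cases z) (simp add: shuffle_minus)
  next
    case (Cons u us)
    show ?case
      using Cons.IH[OF bialt(1)[OF Cons.prems]] Cons.IH[OF bialt(2)[OF Cons.prems]]
      by (cases u) simp
  qed
  moreover have "?bialt h" using assms by blast
  ultimately show ?thesis unfolding alternating_def[of "prod_scale s m"] by blast
qed

lemma split_args_alternating:
  assumes f: "alternating (prod_scale s m) (*) f"
  shows "alternating s (*) (\<lambda>xs. split_args f xs vs)" and "alternating m (*) (split_args f xs)"
proof -
  have *: "(s c x + y, 0) = prod_scale s m c (x, 0) + (y, 0)"
    "(0, m c v + w) = prod_scale s m c (0, v) + (0, w)" for c x y v w
    by (simp_all add: p.scale_def)
  show "alternating s (*) (\<lambda>xs. split_args f xs vs)"
    unfolding alternating_def split_args_def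
    by (simp add: * alternating_linear[OF f] alternating_adjacent[OF f])
  show "alternating m (*) (split_args f xs)"
    unfolding alternating_def split_args_def
    using alternating_linear[OF f, of "_ @ _"] alternating_adjacent[OF f, of "_ @ _"]
    by (simp add: *)
qed

end

section \<open>The differential of a semidirect sum\<close>

text \<open>The number of arguments from \<open>M\<close> is not tested: a cochain of degree \<open>n\<close> vanishes
  unless it is \<open>n - k\<close>.\<close>

definition component :: "nat \<Rightarrow> (('g::zero \<times> 'm::zero) list \<Rightarrow> complex) \<Rightarrow> 'g list \<Rightarrow> 'm list \<Rightarrow> complex"
  where "component k f = (\<lambda>xs vs. if length xs = k then split_args f xs vs else 0)"

lemma component_add: "component k (f + f') = component k f + component k f'"
  by (auto simp: component_def split_args_def fun_eq_iff)

lemma component_scale: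
  "component k (fun_scale (*) c f) = fun_scale (fun_scale (*)) c (component k f)"
  by (auto simp: component_def split_args_def fun_scale_def fun_eq_iff)

lemma component_zero: "component k 0 = 0"
  by (auto simp: component_def split_args_def fun_eq_iff)

lemma mact_alt_forms: "mact (alt_forms l M) x h vs = - leibniz_sum (mact M x) h vs"
  by (simp add: alt_forms_def leibniz_sum_def)

lemma mscale_alt_forms: "mscale (alt_forms l M) = fun_scale (*)"
  by (simp add: alt_forms_def)

lemma vector_space_fun_scale: "vector_space t \<Longrightarrow> vector_space (fun_scale t)"
  by (simp add: vector_space_def fun_scale_def fun_eq_iff)

lemma ce_diff_trivial_diff:
  "ce_diff n \<gg> trivial_module (f - f') = ce_diff n \<gg> trivial_module f - ce_diff n \<gg> trivial_module f'"
  by (rule ext) (simp add: ce_diff_def sum_subtractf right_diff_distrib)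

context
  fixes \<gg> :: "'g::ab_group_add lie_alg" and M :: "('g, 'm::ab_group_add) lie_mod"
  assumes M: "lie_module \<gg> M" and M_UNIV: "mcarrier M = UNIV"
begin

interpretation lie_module \<gg> M by (rule M)

abbreviation (input) "S \<equiv> semidirect \<gg> M"
abbreviation (input) "dS \<equiv> \<lambda>n. ce_diff n (semidirect \<gg> M) trivial_module"
abbreviation (input) "CS \<equiv> \<lambda>n. cochains n (semidirect \<gg> M) trivial_module"

lemma semidirect_scale: "lscale S = prod_scale (lscale \<gg>) (mscale M)"
  by (simp add: semidirect_def)

lemma semidirect_bracket [simp]:
  "lbracket S (x, 0) (y, 0) = (lbracket \<gg> x y, 0)"
  "lbracket S (x, 0) (0, v) = (0, mact M x v)"
  "lbracket S (0, v) (0, w) = 0"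
proof -
  interpret b: Vector_Spaces.linear "lscale \<gg>" "lscale \<gg>" "lbracket \<gg> x" for x
    by (rule linear_right)
  have "mact M x 0 = 0" for x
    using act_add_right[of 0 0 x] by (simp add: M_UNIV)
  moreover have "mact M 0 v = 0" for v
    using act_add_left[of v 0 0] by (simp add: M_UNIV)
  ultimately show
    "lbracket S (x, 0) (y, 0) = (lbracket \<gg> x y, 0)"
    "lbracket S (x, 0) (0, v) = (0, mact M x v)"
    "lbracket S (0, v) (0, w) = 0"
    by (simp_all add: semidirect_def b.zero zero_prod_def)
qed

lemmas vector_space_semidirect =
  vector_space_prod_scale[OF vector_space mod_vector_space, folded semidirect_scale]

lemma cochains_trivial_iff:
  "f \<in> CS n \<longleftrightarrow> (\<forall>zs. length zs \<noteq> n \<longrightarrow> f zs = 0) \<and> alternating (lscale S) (*) f"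
  by (simp add: cochains_def alt_maps_iff_alternating[OF vector_space_semidirect complex_vector_space])

text \<open>A cochain with values in forms is a function that is alternating in each of two lists; this
  symmetric description is the one that matches \<open>split_args\<close> and \<open>shuffle\<close>.\<close>

lemma cochains_alt_forms_iff:
  "F \<in> cochains k \<gg> (alt_forms l M) \<longleftrightarrow>
    (\<forall>xs vs. length xs \<noteq> k \<or> length vs \<noteq> l \<longrightarrow> F xs vs = 0) \<and>
    (\<forall>vs. alternating (lscale \<gg>) (*) (\<lambda>xs. F xs vs)) \<and>
    (\<forall>xs. alternating (mscale M) (*) (F xs))"
proof -
  have 1: "alternating (lscale \<gg>) (fun_scale (*)) F \<longleftrightarrow> (\<forall>vs. alternating (lscale \<gg>) (*) (\<lambda>xs. F xs vs))"
    by (auto simp: alternating_def fun_scale_def fun_eq_iff)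
  have 2: "F \<in> cochains k \<gg> (alt_forms l M) \<longleftrightarrow>
      (\<forall>xs. length xs \<noteq> k \<longrightarrow> F xs = 0) \<and>
      (\<forall>xs. length xs = k \<longrightarrow> F xs \<in> alt_maps (mscale M) (*) UNIV l) \<and>
      alternating (lscale \<gg>) (fun_scale (*)) F"
    by (simp add: cochains_def alt_forms_def
        alt_maps_iff_alternating[OF vector_space vector_space_fun_scale[OF complex_vector_space]])
  note 2 = 2[unfolded 1 alt_maps_iff_alternating[OF mod_vector_space complex_vector_space]]
  have 0: "alternating (mscale M) (*) 0"
    by (simp add: alternating_def)
  show ?thesis (is "_ \<longleftrightarrow> ?R")
  proof
    assume "F \<in> cochains k \<gg> (alt_forms l M)"
    note L = this[unfolded 2]
    have "F xs vs = 0" if "length xs \<noteq> k \<or> length vs \<noteq> l" for xs vs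
      using that L by (cases "length xs = k") simp_all
    moreover have "alternating (mscale M) (*) (F xs)" for xs
      using L 0 by (cases "length xs = k") simp_all
    ultimately show ?R using L by blast
  next
    assume ?R
    then show "F \<in> cochains k \<gg> (alt_forms l M)"
      unfolding 2 by (simp add: fun_eq_iff)
  qed
qed

lemma component_cochain:
  assumes f: "f \<in> CS n" and kl: "k + l = n"
  shows "component k f \<in> cochains k \<gg> (alt_forms l M)"
proof -
  have alt: "alternating (prod_scale (lscale \<gg>) (mscale M)) (*) f"
    and zero: "\<And>zs. length zs \<noteq> n \<Longrightarrow> f zs = 0"
    using f by (simp_all add: cochains_trivial_iff semidirect_scale)
  note split = split_args_alternating[OF vector_space mod_vector_space alt]
  have "component k f xs vs = 0" if "length xs \<noteq> k \<or> length vs \<noteq> l" for xs vs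
    using that kl by (auto simp: component_def split_args_def intro: zero)
  moreover have "alternating (lscale \<gg>) (*) (\<lambda>xs. component k f xs vs)" for vs
    using split(1)[of vs] by (simp add: alternating_def component_def)
  moreover have "alternating (mscale M) (*) (component k f xs)" for xs
    using split(2)[of xs] by (simp add: alternating_def component_def)
  ultimately show ?thesis by (simp add: cochains_alt_forms_iff)
qed

lemma component_eq_zero_imp:
  assumes f: "f \<in> CS n" and zero: "\<And>k. k \<le> n \<Longrightarrow> component k f = 0"
  shows "f = 0"
proof -
  have "split_args f xs vs = 0" for xs vs
  proof (cases "length xs \<le> n")
    case True
    then have "component (length xs) f xs vs = 0"
      by (simp add: zero)
    then show ?thesis by (simp add: component_def)
  next
    case False
    then show ?thesis using f by (simp add: split_args_def cochains_trivial_iff)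
  qed
  then have "split_args f = (\<lambda>xs vs. 0)" by (simp add: fun_eq_iff)
  then show ?thesis
    using shuffle_split_args[OF vector_space mod_vector_space] f
    by (metis cochains_trivial_iff ext semidirect_scale shuffle_zero zero_fun_apply)
qed

lemma components_surjective:
  assumes H: "\<And>k. k \<le> n \<Longrightarrow> H k \<in> cochains k \<gg> (alt_forms (n - k) M)"
  obtains f where "f \<in> CS n" and "\<And>k. k \<le> n \<Longrightarrow> component k f = H k"
proof -
  \<comment> \<open>one function of two lists that carries the whole family, the lengths selecting the member\<close>
  define h where "h xs vs = (if length xs + length vs = n then H (length xs) xs vs else 0)" for xs vs
  define f where "f zs = (if length zs = n then shuffle h zs else 0)" for zs
  have h1: "alternating (lscale \<gg>) (*) (\<lambda>xs. h xs vs)" for vs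
  proof -
    have "alternating (lscale \<gg>) (*) (\<lambda>xs. H k xs vs)" if "k \<le> n" for k
      using H[OF that] by (simp add: cochains_alt_forms_iff)
    then show ?thesis by (auto simp: alternating_def h_def)
  qed
  have h2: "alternating (mscale M) (*) (h xs)" for xs
  proof -
    have "alternating (mscale M) (*) (H k ys)" if "k \<le> n" for k ys
      using H[OF that] by (simp add: cochains_alt_forms_iff)
    then show ?thesis by (auto simp: alternating_def h_def)
  qed
  have "alternating (lscale S) (*) (shuffle h)"
    using shuffle_alternating[OF vector_space mod_vector_space h1 h2] by (simp add: semidirect_scale)
  then have "alternating (lscale S) (*) f"
    by (simp add: alternating_def f_def)
  then have 1: "f \<in> CS n"
    by (simp add: cochains_trivial_iff f_def)
  have sh: "split_args (shuffle h) xs vs = h xs vs" for xs vs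
    using split_args_shuffle[of h] alternating_zero[OF vector_space complex_vector_space h1]
      alternating_zero[OF mod_vector_space complex_vector_space h2] by blast
  have "component k f xs vs = H k xs vs" if "k \<le> n" for k xs vs
  proof (cases "length xs = k \<and> length vs = n - k")
    case True
    then show ?thesis
      using that sh[of xs vs] by (auto simp: component_def split_args_def f_def h_def)
  next
    case False
    then have "component k f xs vs = 0"
      using that by (auto simp: component_def split_args_def f_def)
    then show ?thesis using H[OF that] False by (auto simp: cochains_alt_forms_iff)
  qed
  then have 2: "component k f = H k" if "k \<le> n" for k
    using that by (simp add: fun_eq_iff)
  from that[OF 1 2] show thesis .
qed

lemma cartan_diff_Pair_zero:
  assumes "alternating (lscale S) (*) f"
  shows "cartan_diff S trivial_module f (map (Pair 0) vs) = 0"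
  using assms
proof (induction vs arbitrary: f)
  case (Cons v vs)
  note zero = alternating_zero[OF vector_space_semidirect complex_vector_space Cons.prems]
  have "leibniz_sum (lbracket S (0, v)) f (map (Pair 0) vs) = 0"
    using zero by (simp add: leibniz_sum_def upd_conv_take_nth_drop)
  then show ?case using Cons.IH[OF alternating_Cons[OF Cons.prems]] by simp
qed simp

text \<open>The Lie derivative along \<open>(x, 0)\<close> on \<open>xs\<close> followed by \<open>vs\<close> has two parts. On \<open>xs\<close> it is the Lie
  derivative of \<open>\<gg>\<close>; on \<open>vs\<close> it is the action of \<open>x\<close> on forms on \<open>M\<close>, which is the coefficient term
  of the differential of \<open>\<gg>\<close>. So both sides satisfy the same recursion in \<open>xs\<close>.\<close>

lemma split_args_cartan_diff:
  assumes "alternating (lscale S) (*) f"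
  shows "split_args (cartan_diff S trivial_module f) xs vs = cartan_diff \<gg> (alt_forms l M) (split_args f) xs vs"
  using assms
proof (induction xs arbitrary: f)
  case Nil
  then show ?case by (simp add: split_args_def cartan_diff_Pair_zero)
next
  case (Cons x xs)
  have "split_args (\<lambda>ys. f ((x, 0) # ys)) = (\<lambda>ys. split_args f (x # ys))"
    by (simp add: split_args_def fun_eq_iff)
  then have "split_args (cartan_diff S trivial_module (\<lambda>ys. f ((x, 0) # ys))) xs vs =
      cartan_diff \<gg> (alt_forms l M) (\<lambda>ys. split_args f (x # ys)) xs vs"
    using Cons.IH[OF alternating_Cons[OF Cons.prems]] by simp
  moreover have "leibniz_sum (lbracket S (x, 0)) f (map (\<lambda>x. (x, 0)) xs @ map (Pair 0) vs) =
      leibniz_sum (lbracket \<gg> x) (\<lambda>us. split_args f us vs) xs + leibniz_sum (mact M x) (split_args f xs) vs"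
    unfolding leibniz_sum_append split_args_def
    by (intro arg_cong2[where f = "(+)"] leibniz_sum_map) simp_all
  moreover have "split_args (cartan_diff S trivial_module f) (x # xs) vs =
      - leibniz_sum (lbracket S (x, 0)) f (map (\<lambda>x. (x, 0)) xs @ map (Pair 0) vs)
      - split_args (cartan_diff S trivial_module (\<lambda>ys. f ((x, 0) # ys))) xs vs"
    by (simp add: split_args_def)
  ultimately show ?case
    by (simp add: mact_alt_forms leibniz_sum_apply)
qed

lemma ce_diff_semidirect: "f \<in> CS n \<Longrightarrow> dS n f = cartan_diff S trivial_module f"
proof (rule ext)
  fix zs assume f: "f \<in> CS n"
  have "cartan_diff S trivial_module f zs = cartan_diff S trivial_module (\<lambda>_. 0) zs" if "length zs \<noteq> Suc n"
    by (rule cartan_diff_cong) (use f that in \<open>auto simp: cochains_trivial_iff\<close>)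
  then show "dS n f zs = cartan_diff S trivial_module f zs"
    using f by (simp add: cochains_trivial_iff ce_diff_eq_cartan_diff vector_space_semidirect complex_vector_space)
qed

lemma ce_diff_cochain:
  assumes f: "f \<in> CS n"
  shows "dS n f \<in> CS (Suc n)"
proof -
  have "alternating (lscale S) (*) (dS n f)"
    using cartan_diff_alternating[OF semidirect_lie_algebra[OF M M_UNIV], of f] f
    by (simp add: ce_diff_semidirect cochains_trivial_iff)
  then show ?thesis by (simp add: cochains_trivial_iff) (simp add: ce_diff_def)
qed

lemma component_Suc_ce_diff:
  assumes f: "f \<in> CS n" and kl: "k + l = n"
  shows "component (Suc k) (dS n f) = ce_diff k \<gg> (alt_forms l M) (component k f)"
proof (intro ext)
  fix xs vs
  have alt: "alternating (lscale S) (*) f" and zero: "\<And>zs. length zs \<noteq> n \<Longrightarrow> f zs = 0"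
    using f by (simp_all add: cochains_trivial_iff)
  have "component k f \<in> cochains k \<gg> (alt_forms l M)"
    by (rule component_cochain[OF f kl])
  then have alt': "alternating (lscale \<gg>) (mscale (alt_forms l M)) (component k f)"
    by (simp add: cochains_alt_forms_iff mscale_alt_forms alternating_def fun_scale_def fun_eq_iff)
  have v: "vector_space (mscale (alt_forms l M))"
    by (simp add: mscale_alt_forms vector_space_fun_scale complex_vector_space)
  have R: "ce_diff k \<gg> (alt_forms l M) (component k f) xs vs =
      (if length xs = Suc k then cartan_diff \<gg> (alt_forms l M) (component k f) xs vs else 0)"
    by (simp add: ce_diff_eq_cartan_diff[OF vector_space v alt'])
  show "component (Suc k) (dS n f) xs vs = ce_diff k \<gg> (alt_forms l M) (component k f) xs vs"
  proof (cases "length xs = Suc k")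
    case True
    have "cartan_diff \<gg> (alt_forms l M) (component k f) xs = cartan_diff \<gg> (alt_forms l M) (split_args f) xs"
      by (rule cartan_diff_cong) (simp add: component_def True)
    then show ?thesis
      by (simp add: R True component_def[of "Suc k"] ce_diff_semidirect[OF f] split_args_cartan_diff[OF alt])
  next
    case False
    then show ?thesis by (simp add: R component_def[of "Suc k"])
  qed
qed

lemma component_0_ce_diff:
  assumes f: "f \<in> CS n"
  shows "component 0 (dS n f) = 0"
  using f cartan_diff_Pair_zero
  by (auto simp: component_def split_args_def fun_eq_iff cochains_trivial_iff ce_diff_semidirect)

section \<open>Cocycles and coboundaries in components\<close>

lemma cochains_trivial_diff: "f \<in> CS n \<Longrightarrow> f' \<in> CS n \<Longrightarrow> f - f' \<in> CS n"
  unfolding cochains_trivial_iff alternating_def by (simp add: right_diff_distrib)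

lemma cochains_trivial_zero: "0 \<in> CS n"
  unfolding cochains_trivial_iff alternating_def by simp

lemma coboundaries_zero: "0 \<in> coboundaries n S trivial_module"
proof (cases n)
  case (Suc n')
  have "dS n' 0 = 0"
    using ce_diff_trivial_diff[of n' S 0 0] by simp
  moreover have "dS n' 0 \<in> dS n' ` CS n'"
    by (rule imageI) (rule cochains_trivial_zero)
  ultimately show ?thesis by (simp add: Suc)
qed simp

lemma coboundaries_diff:
  "u \<in> coboundaries n S trivial_module \<Longrightarrow> v \<in> coboundaries n S trivial_module \<Longrightarrow>
    u - v \<in> coboundaries n S trivial_module"
  by (cases n) (auto simp flip: ce_diff_trivial_diff intro: cochains_trivial_diff)

lemma cocycles_diff:
  "u \<in> cocycles n S trivial_module \<Longrightarrow> v \<in> cocycles n S trivial_module \<Longrightarrow>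
    u - v \<in> cocycles n S trivial_module"
  by (simp add: cocycles_def cochains_trivial_diff ce_diff_trivial_diff)

lemma component_cocycle:
  assumes "z \<in> cocycles n S trivial_module" and "k + l = n"
  shows "component k z \<in> cocycles k \<gg> (alt_forms l M)"
  using assms component_cochain[of z n k l] component_Suc_ce_diff[of z n k l]
  by (simp add: cocycles_def component_zero)

lemma components_cocycle_surjective:
  assumes w: "\<And>k. k \<le> n \<Longrightarrow> w k \<in> cocycles k \<gg> (alt_forms (n - k) M)"
  obtains z where "z \<in> cocycles n S trivial_module" and "\<And>k. k \<le> n \<Longrightarrow> component k z = w k"
proof -
  have wc: "w k \<in> cochains k \<gg> (alt_forms (n - k) M)" "ce_diff k \<gg> (alt_forms (n - k) M) (w k) = 0"
    if "k \<le> n" for k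
    using w[OF that] by (simp_all add: cocycles_def)
  obtain z where z: "z \<in> CS n" "\<And>k. k \<le> n \<Longrightarrow> component k z = w k"
    using components_surjective[OF wc(1)] by blast
  have "component k (dS n z) = 0" if "k \<le> Suc n" for k
  proof (cases k)
    case 0
    then show ?thesis using component_0_ce_diff[OF z(1)] by simp
  next
    case (Suc k')
    then show ?thesis
      using component_Suc_ce_diff[OF z(1), of k' "n - k'"] z(2) wc(2) that by simp
  qed
  then have "dS n z = 0"
    by (rule component_eq_zero_imp[OF ce_diff_cochain[OF z(1)]])
  then show thesis using that z by (simp add: cocycles_def)
qed

text \<open>To hit \<open>d c\<close> with \<open>c\<close> of degree \<open>k - 1\<close>, take the cochain whose only nonzero component is \<open>c\<close>. For
  \<open>k = 0\<close> both sides are \<open>{0}\<close>.\<close>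

lemma component_image_coboundaries:
  assumes kl: "k + l = n"
  shows "component k ` coboundaries n S trivial_module = coboundaries k \<gg> (alt_forms l M)"
proof (cases k)
  case 0
  have "component 0 b = 0" if "b \<in> coboundaries n S trivial_module" for b
    using that component_0_ce_diff by (cases n) (auto simp: component_zero)
  then show ?thesis
    using coboundaries_zero[of n] by (force simp: 0)
next
  case k: (Suc k')
  then obtain n' where n: "n = Suc n'" and kl': "k' + l = n'" using kl by auto
  have "ce_diff k' \<gg> (alt_forms l M) c \<in> component k ` dS n' ` CS n'"
    if c: "c \<in> cochains k' \<gg> (alt_forms l M)" for c
  proof -
    have "(if j = k' then c else 0) \<in> cochains j \<gg> (alt_forms (n' - j) M)" for j
      using c kl' by (auto simp: cochains_alt_forms_iff alternating_def)
    then obtain f where f: "f \<in> CS n'" "\<And>j. j \<le> n' \<Longrightarrow> component j f = (if j = k' then c else 0)"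
      using components_surjective[of n' "\<lambda>j. if j = k' then c else 0"] by blast
    then have "ce_diff k' \<gg> (alt_forms l M) c = component k (dS n' f)"
      using component_Suc_ce_diff[OF f(1) kl'] kl' k by simp
    then show ?thesis using f(1) by blast
  qed
  moreover have "component k (dS n' f) \<in> ce_diff k' \<gg> (alt_forms l M) ` cochains k' \<gg> (alt_forms l M)"
    if "f \<in> CS n'" for f
    using component_Suc_ce_diff[OF that kl'] component_cochain[OF that kl'] k by simp
  ultimately show ?thesis by (auto simp: n k)
qed

lemma coboundary_if_components:
  assumes z: "z \<in> CS n"
    and b: "\<And>k. k \<le> n \<Longrightarrow> component k z \<in> coboundaries k \<gg> (alt_forms (n - k) M)"
  shows "z \<in> coboundaries n S trivial_module"
proof (cases n)
  case 0
  have "z = 0"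
    using b by (intro component_eq_zero_imp[OF z]) (simp add: 0)
  then show ?thesis by (simp add: 0)
next
  case n: (Suc n')
  have "\<exists>c. c \<in> cochains k \<gg> (alt_forms (n' - k) M) \<and>
      component (Suc k) z = ce_diff k \<gg> (alt_forms (n' - k) M) c" if "k \<le> n'" for k
    using b[of "Suc k"] that n by auto
  then obtain c where c: "\<And>k. k \<le> n' \<Longrightarrow> c k \<in> cochains k \<gg> (alt_forms (n' - k) M)"
    "\<And>k. k \<le> n' \<Longrightarrow> component (Suc k) z = ce_diff k \<gg> (alt_forms (n' - k) M) (c k)"
    by metis
  obtain f where f: "f \<in> CS n'" "\<And>k. k \<le> n' \<Longrightarrow> component k f = c k"
    using components_surjective[OF c(1)] by blast
  have "component k z = component k (dS n' f)" if "k \<le> n" for k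
  proof (cases k)
    case 0
    then show ?thesis using b[of 0] component_0_ce_diff[OF f(1)] by simp
  next
    case (Suc k')
    then show ?thesis
      using that n c(2) f component_Suc_ce_diff[OF f(1), of k' "n' - k'"] by simp
  qed
  then have "component k (z - dS n' f) = 0" if "k \<le> n" for k
    using that component_add[of k "z - dS n' f" "dS n' f"] by simp
  moreover have "z - dS n' f \<in> CS n"
    using cochains_trivial_diff z ce_diff_cochain[OF f(1)] n by simp
  ultimately have "z - dS n' f = 0"
    using component_eq_zero_imp by blast
  then show ?thesis using f(1) n by simp
qed

end

section \<open>Quotients of direct sums\<close>

lemma elt_set_plus_eq_image: "u +o A = (+) u ` A"
  by (auto simp: elt_set_plus_def)

text \<open>The isomorphism sends a coset \<open>X\<close> to the family of its images \<open>\<Psi> i ` X\<close>. No representatives are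
  chosen, so compatibility with the operations on cosets is just additivity and homogeneity of each
  \<open>\<Psi> i\<close> together with \<open>\<Psi> i ` B = B' i\<close>.\<close>

lemma quotient_space_direct_sum:
  fixes \<Psi> :: "'i \<Rightarrow> 'v::ab_group_add \<Rightarrow> 'w::ab_group_add"
  assumes add: "\<And>i u v. i \<in> I \<Longrightarrow> \<Psi> i (u + v) = \<Psi> i u + \<Psi> i v"
    and scale: "\<And>i c u. i \<in> I \<Longrightarrow> \<Psi> i (s c u) = t i c (\<Psi> i u)"
    and B: "0 \<in> B" "\<And>u v. u \<in> B \<Longrightarrow> v \<in> B \<Longrightarrow> u - v \<in> B"
    and Z: "\<And>u v. u \<in> Z \<Longrightarrow> v \<in> Z \<Longrightarrow> u - v \<in> Z"
    and B_image: "\<And>i. i \<in> I \<Longrightarrow> \<Psi> i ` B = B' i"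
    and B_detect: "\<And>z. z \<in> Z \<Longrightarrow> (\<And>i. i \<in> I \<Longrightarrow> \<Psi> i z \<in> B' i) \<Longrightarrow> z \<in> B"
    and Z_image: "\<And>i z. i \<in> I \<Longrightarrow> z \<in> Z \<Longrightarrow> \<Psi> i z \<in> Z' i"
    and Z_surj: "\<And>w. (\<And>i. i \<in> I \<Longrightarrow> w i \<in> Z' i) \<Longrightarrow> \<exists>z\<in>Z. \<forall>i\<in>I. \<Psi> i z = w i"
  shows "quotient_space s Z B \<cong>\<^sub>\<complex> finite_direct_sum I (\<lambda>i. quotient_space (t i) (Z' i) (B' i))"
proof -
  define \<phi> where "\<phi> X = (\<lambda>i\<in>I. \<Psi> i ` X)" for X
  have zero: "\<Psi> i 0 = 0" if "i \<in> I" for i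
    using add[OF that, of 0 0] by simp
  have coset: "\<Psi> i ` (z +o B) = \<Psi> i z +o B' i" if "i \<in> I" for i z
    by (simp add: elt_set_plus_eq_image B_image[OF that, symmetric] image_image add[OF that])
  have plus: "\<Psi> i ` (X + Y) = \<Psi> i ` X + \<Psi> i ` Y" if "i \<in> I" for i X Y
  proof (intro equalityI subsetI)
    fix y assume "y \<in> \<Psi> i ` (X + Y)"
    then obtain a b where "a \<in> X" "b \<in> Y" "y = \<Psi> i (a + b)"
      by (auto elim!: set_plus_elim)
    then show "y \<in> \<Psi> i ` X + \<Psi> i ` Y"
      by (simp add: add[OF that] set_plus_intro)
  next
    fix y assume "y \<in> \<Psi> i ` X + \<Psi> i ` Y"
    then obtain a b where ab: "a \<in> X" "b \<in> Y" "y = \<Psi> i a + \<Psi> i b"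
      by (auto elim!: set_plus_elim)
    then have "y = \<Psi> i (a + b)"
      by (simp add: add[OF that])
    then show "y \<in> \<Psi> i ` (X + Y)"
      using ab(1,2) by (blast intro: set_plus_intro)
  qed
  have "inj_on \<phi> ((\<lambda>z. z +o B) ` Z)"
  proof (rule inj_onI, clarify)
    fix z z' assume z: "z \<in> Z" "z' \<in> Z" and eq: "\<phi> (z +o B) = \<phi> (z' +o B)"
    have "\<Psi> i (z - z') \<in> B' i" if i: "i \<in> I" for i
    proof -
      have "\<Psi> i z +o B' i = \<Psi> i z' +o B' i"
        using fun_cong[OF eq, of i] i by (simp add: \<phi>_def coset)
      moreover have "0 \<in> B' i"
        using B(1) B_image[OF i] zero[OF i] by force
      then have "\<Psi> i z \<in> \<Psi> i z +o B' i"
        using set_plus_intro2[of 0 "B' i" "\<Psi> i z"] by simp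
      ultimately have "\<Psi> i z \<in> \<Psi> i z' +o B' i" by simp
      then obtain b where "b \<in> B' i" "\<Psi> i z = \<Psi> i z' + b"
        unfolding elt_set_plus_def by blast
      then show ?thesis using add[OF i, of "z - z'" z'] by simp
    qed
    then have d: "z - z' \<in> B" using B_detect Z z by blast
    have "z + b \<in> z' +o B \<and> z' + b \<in> z +o B" if "b \<in> B" for b
    proof -
      have "b - (0 - (z - z')) \<in> B" "b - (z - z') \<in> B"
        using B d that by blast+
      then have "z' + (b - (0 - (z - z'))) \<in> z' +o B" "z + (b - (z - z')) \<in> z +o B"
        by (simp_all only: set_plus_intro2)
      then show ?thesis by (simp add: add.commute)
    qed
    then show "z +o B = z' +o B" by (auto simp: elt_set_plus_def)
  qed
  moreover have "\<phi> ` (\<lambda>z. z +o B) ` Z = (\<Pi>\<^sub>E i\<in>I. (\<lambda>z. z +o B' i) ` Z' i)"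
  proof (intro equalityI subsetI)
    fix X assume "X \<in> \<phi> ` (\<lambda>z. z +o B) ` Z"
    then show "X \<in> (\<Pi>\<^sub>E i\<in>I. (\<lambda>z. z +o B' i) ` Z' i)"
      using Z_image by (auto simp: \<phi>_def coset)
  next
    fix X assume X: "X \<in> (\<Pi>\<^sub>E i\<in>I. (\<lambda>z. z +o B' i) ` Z' i)"
    then have "\<forall>i\<in>I. \<exists>w. w \<in> Z' i \<and> X i = w +o B' i" by fastforce
    then obtain w where w: "\<And>i. i \<in> I \<Longrightarrow> w i \<in> Z' i" "\<And>i. i \<in> I \<Longrightarrow> X i = w i +o B' i"
      by metis
    obtain z where z: "z \<in> Z" "\<forall>i\<in>I. \<Psi> i z = w i" using Z_surj[of w] w(1) by blast
    have "X = \<phi> (z +o B)"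
    proof (rule ext)
      fix i show "X i = \<phi> (z +o B) i"
      proof (cases "i \<in> I")
        case True
        then have "X i = w i +o B' i" and "\<Psi> i z = w i"
          using w(2) z(2) by blast+
        then show ?thesis using True by (simp add: \<phi>_def coset)
      next
        case False
        then show ?thesis using PiE_arb[OF X False] by (simp add: \<phi>_def)
      qed
    qed
    then show "X \<in> \<phi> ` (\<lambda>z. z +o B) ` Z" using z(1) by blast
  qed
  moreover have "\<phi> (X + Y) = (\<lambda>i\<in>I. \<phi> X i + \<phi> Y i)" for X Y
    by (rule ext) (simp add: \<phi>_def plus)
  moreover have "\<phi> (s c ` X + B) = (\<lambda>i\<in>I. t i c ` \<phi> X i + B' i)" for c X
    by (rule ext) (simp add: \<phi>_def plus B_image image_image scale)
  ultimately show ?thesis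
    unfolding cvspace_isomorphic_def
    by (intro exI[of _ \<phi>]) (simp add: bij_betw_def quotient_space_def finite_direct_sum_def)
qed

theorem proposition1p4:
  fixes \<gg> :: "'g::ab_group_add lie_alg"
    and M :: "('g, 'm::ab_group_add) lie_mod"
    and n :: nat
  assumes "lie_algebra \<gg>"
    and "lie_module \<gg> M"
    and "mcarrier M = UNIV"
  shows "ce_cohomology n (semidirect \<gg> M) trivial_module \<cong>\<^sub>\<complex>
    finite_direct_sum {(k, l). k + l = n} (\<lambda>(k, l). ce_cohomology k \<gg> (alt_forms l M))"
proof -
  note M = assms(2,3)
  let ?I = "{(k, l). k + l = n}"
  have "quotient_space (fun_scale (*)) (cocycles n (semidirect \<gg> M) trivial_module)
      (coboundaries n (semidirect \<gg> M) trivial_module) \<cong>\<^sub>\<complex>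
    finite_direct_sum ?I (\<lambda>i. quotient_space (fun_scale (fun_scale (*)))
      (cocycles (fst i) \<gg> (alt_forms (snd i) M)) (coboundaries (fst i) \<gg> (alt_forms (snd i) M)))"
  proof (rule quotient_space_direct_sum[where \<Psi> = "\<lambda>i. component (fst i)"])
    show "z \<in> coboundaries n (semidirect \<gg> M) trivial_module"
      if z: "z \<in> cocycles n (semidirect \<gg> M) trivial_module"
      and b: "\<And>i. i \<in> ?I \<Longrightarrow>
        component (fst i) z \<in> coboundaries (fst i) \<gg> (alt_forms (snd i) M)" for z
      by (rule coboundary_if_components[OF M]) (use z b[of "(_, n - _)"] in \<open>simp_all add: cocycles_def\<close>)
    show "\<exists>z\<in>cocycles n (semidirect \<gg> M) trivial_module. \<forall>i\<in>?I. component (fst i) z = w i"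
      if w: "\<And>i. i \<in> ?I \<Longrightarrow> w i \<in> cocycles (fst i) \<gg> (alt_forms (snd i) M)" for w
    proof -
      have "w (k, n - k) \<in> cocycles k \<gg> (alt_forms (n - k) M)" if "k \<le> n" for k
        using w[of "(k, n - k)"] that by simp
      then obtain z where z: "z \<in> cocycles n (semidirect \<gg> M) trivial_module"
        "\<And>k. k \<le> n \<Longrightarrow> component k z = w (k, n - k)"
        using components_cocycle_surjective[OF M, of n "\<lambda>k. w (k, n - k)"] by blast
      have "component (fst i) z = w i" if "i \<in> ?I" for i
        using that z(2) by auto
      then show ?thesis using z(1) by blast
    qed
    show "component (fst i) ` coboundaries n (semidirect \<gg> M) trivial_module =
        coboundaries (fst i) \<gg> (alt_forms (snd i) M)" if "i \<in> ?I" for i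
      by (rule component_image_coboundaries[OF M]) (use that in auto)
  qed (auto simp: component_add component_scale coboundaries_zero[OF M]
      intro: coboundaries_diff[OF M] cocycles_diff[OF M] component_cocycle[OF M])
  then show ?thesis
    by (simp add: ce_cohomology_def case_prod_unfold mscale_alt_forms)
qed

end
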